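(* Let $(M;c)$ be a modular coloured matroid for which $c$ is simple. The following are equivalent: (i) $(M;c)$ has no rainbow triangle; (ii) $(M;c)$ has no rainbow circuit; (iii) $|c(X)|\le r_M(X)$ for all $X\subseteq E(M)$; (iv) $|c(F)|\le r_M(F)$ for every flat $F$ of $M$.
   Context: A coloured matroid $(M;c)$ is a (finite) matroid with a function $c$ on $E(M)$. The colouring $c$ is simple (with respect to $M$) if $M$ has no loop and $c(e)=c(f)$ whenever $e,f$ are parallel in $M$. A set is rainbow if $c$ is injective on it. $M$ is modular if $r_M(F)+r_M(F')=r_M(F\cup F')+r_M(F\cap F')$ for all flats $F,F'$. A triangle is a three-element circuit. $c(X)$ is the set of colours appearing on $X$. *)

theory Defs
  imports Main
begin

locale matroid =
  fixes E :: "'a set" and indep :: "'a set \<Rightarrow> bool"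
  assumes finite_ground: "finite E"
    and indep_subset_ground: "indep X \<Longrightarrow> X \<subseteq> E"
    and indep_empty: "indep {}"
    and indep_mono: "indep Y \<Longrightarrow> X \<subseteq> Y \<Longrightarrow> indep X"
    and augmentation: "indep X \<Longrightarrow> indep Y \<Longrightarrow> card X < card Y \<Longrightarrow>
      \<exists>e\<in>Y - X. indep (insert e X)"
begin

definition rank :: "'a set \<Rightarrow> nat" where
  "rank X = Max {card I | I. I \<subseteq> X \<and> indep I}"

definition circuit :: "'a set \<Rightarrow> bool" where
  "circuit C \<longleftrightarrow> C \<subseteq> E \<and> \<not> indep C \<and> (\<forall>D. D \<subset> C \<longrightarrow> indep D)"

definition triangle :: "'a set \<Rightarrow> bool" where
  "triangle T \<longleftrightarrow> circuit T \<and> card T = 3"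

definition loop :: "'a \<Rightarrow> bool" where
  "loop e \<longleftrightarrow> circuit {e}"

definition parallel :: "'a \<Rightarrow> 'a \<Rightarrow> bool" where
  "parallel e f \<longleftrightarrow> e \<noteq> f \<and> circuit {e, f}"

definition flat :: "'a set \<Rightarrow> bool" where
  "flat F \<longleftrightarrow> F \<subseteq> E \<and> (\<forall>e\<in>E - F. rank F < rank (insert e F))"

definition modular :: bool where
  "modular \<longleftrightarrow> (\<forall>F F'. flat F \<longrightarrow> flat F' \<longrightarrow>
     rank F + rank F' = rank (F \<union> F') + rank (F \<inter> F'))"

text \<open>
  A colouring is a total function \<open>c\<close>; only its values on the ground set matter.
\<close>

definition simple_colouring :: "('a \<Rightarrow> 'c) \<Rightarrow> bool" where
  "simple_colouring c \<longleftrightarrow>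
     (\<forall>e\<in>E. \<not> loop e) \<and> (\<forall>e\<in>E. \<forall>f\<in>E. parallel e f \<longrightarrow> c e = c f)"

end

definition rainbow :: "('a \<Rightarrow> 'c) \<Rightarrow> 'a set \<Rightarrow> bool" where
  "rainbow c X \<longleftrightarrow> inj_on c X"

end

(* A dependent rainbow set C of least size n is a circuit with n \<ge> 4 when there is no rainbow
   triangle. For distinct e, f in C, modularity yields a point x on both the line spanned by e, f
   and the flat spanned by C - {e, f}. Either {e, f, x} is rainbow, or x repeats the colour of e
   or f and then C - {e, f} together with x is rainbow; both sets are dependent and smaller
   than C. *)
theory Submission
  imports Defs
begin

context matroid
begin

section \<open>Rank and bases\<close>

lemma finite_indep: "indep I \<Longrightarrow> finite I"
  using finite_ground indep_subset_ground finite_subset by blast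

text \<open>Independent sets have at most \<open>card E\<close> elements, so the \<open>Max\<close>
  defining \<open>rank\<close> is taken over a finite set and is attained.\<close>

lemma finite_indep_cards: "finite {card I | I. I \<subseteq> X \<and> indep I}"
proof (rule finite_subset)
  show "{card I | I. I \<subseteq> X \<and> indep I} \<subseteq> {..card E}"
    using card_mono[OF finite_ground indep_subset_ground] by auto
qed simp

lemma card_le_rank: "I \<subseteq> X \<Longrightarrow> indep I \<Longrightarrow> card I \<le> rank X"
  unfolding rank_def by (intro Max_ge finite_indep_cards) blast

lemma obtain_basis:
  obtains B where "B \<subseteq> X" "indep B" "card B = rank X"
proof -
  have "rank X \<in> {card I | I. I \<subseteq> X \<and> indep I}"
    unfolding rank_def using indep_empty by (intro Max_in finite_indep_cards) blast
  then show thesis using that by auto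
qed

lemma rank_le_iff: "rank X \<le> n \<longleftrightarrow> (\<forall>I. I \<subseteq> X \<and> indep I \<longrightarrow> card I \<le> n)"
  by (metis card_le_rank obtain_basis order_trans)

lemma rank_mono: "X \<subseteq> Y \<Longrightarrow> rank X \<le> rank Y"
  by (meson card_le_rank rank_le_iff subset_trans)

lemma rank_le_card: "finite X \<Longrightarrow> rank X \<le> card X"
  by (simp add: rank_le_iff card_mono)

lemma rank_indep: "indep I \<Longrightarrow> rank I = card I"
  by (simp add: card_le_rank finite_indep rank_le_card le_antisym)

text \<open>In the case of equality, an independent subset of maximum size would be all of
  \<open>X\<close>.\<close>

lemma rank_less_card: "finite X \<Longrightarrow> \<not> indep X \<Longrightarrow> rank X < card X"
  by (metis card_subset_eq le_neq_implies_less obtain_basis rank_le_card)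

lemma augment_to_rank:
  assumes "indep I" "card I < rank X"
  obtains e where "e \<in> X - I" "indep (insert e I)"
  by (metis Diff_iff assms augmentation obtain_basis subsetD)

text \<open>Repeated augmentation inside \<open>X\<close>: the induction runs on the gap between
  \<open>card I\<close> and \<open>rank X\<close>, which each added element narrows.\<close>

lemma extend_to_basis:
  assumes "indep I" "I \<subseteq> X"
  obtains B where "I \<subseteq> B" "B \<subseteq> X" "indep B" "card B = rank X"
proof -
  have "\<exists>B. I \<subseteq> B \<and> B \<subseteq> X \<and> indep B \<and> card B = rank X"
    using assms
  proof (induction "rank X - card I" arbitrary: I rule: less_induct)
    case less
    show ?case
    proof (cases "card I < rank X")
      case True
      then obtain e where e: "e \<in> X - I" "indep (insert e I)"
        using augment_to_rank less.prems(1) by metis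
      then have "card (insert e I) = Suc (card I)"
        using finite_indep[OF less.prems(1)] by simp
      then have "rank X - card (insert e I) < rank X - card I"
        using True by simp
      with less.hyps[of "insert e I"] e less.prems(2) show ?thesis by auto
    next
      case False
      then show ?thesis
        using card_le_rank less.prems by (meson le_antisym not_less order_refl)
    qed
  qed
  then show thesis using that by blast
qed

section \<open>Closures and flats\<close>

definition closure :: "'a set \<Rightarrow> 'a set" where
  "closure X = {e \<in> E. rank (insert e X) = rank X}"

lemma closure_subset_ground: "closure X \<subseteq> E"
  by (auto simp: closure_def)

lemma subset_closure: "X \<subseteq> E \<Longrightarrow> X \<subseteq> closure X"
  by (auto simp: closure_def insert_absorb)

text \<open>Otherwise \<open>insert e X\<close> would contain an independent set with
  \<open>rank X + 1\<close> elements, although \<open>e\<close> does not raise the rank of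
  \<open>X\<close>.\<close>

lemma closure_not_indep_insert:
  assumes "e \<in> closure X" "B \<subseteq> X" "indep B" "card B = rank X" "e \<notin> B"
  shows "\<not> indep (insert e B)"
proof
  assume "indep (insert e B)"
  then have "card (insert e B) \<le> rank (insert e X)"
    using assms(2) by (intro card_le_rank) auto
  then show False
    using assms finite_indep[of B] by (simp add: closure_def)
qed

lemma rank_closure: "X \<subseteq> E \<Longrightarrow> rank (closure X) = rank X"
proof (rule antisym)
  obtain B where B: "B \<subseteq> X" "indep B" "card B = rank X" by (rule obtain_basis)
  show "rank (closure X) \<le> rank X"
    using augment_to_rank[OF B(2)] closure_not_indep_insert[OF _ B] B(3)
    by (metis Diff_iff not_less)
qed (simp add: rank_mono subset_closure)

text \<open>An element outside the closure raises the rank of \<open>X\<close>, and the closure has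
  the same rank as \<open>X\<close>.\<close>

lemma flat_closure:
  assumes "X \<subseteq> E"
  shows "flat (closure X)"
  unfolding flat_def
proof (intro conjI ballI closure_subset_ground)
  fix e assume e: "e \<in> E - closure X"
  have "rank X \<noteq> rank (insert e X)"
    using e by (auto simp: closure_def)
  then have "rank X < rank (insert e X)"
    using rank_mono[OF subset_insertI, of X e] by linarith
  also have "\<dots> \<le> rank (insert e (closure X))"
    using subset_closure[OF assms] by (intro rank_mono) auto
  finally show "rank (closure X) < rank (insert e (closure X))"
    using rank_closure[OF assms] by simp
qed

text \<open>Extend a basis \<open>B\<close> of \<open>X\<close> to a basis \<open>J\<close> of
  \<open>Y\<close>. If \<open>e\<close> raised the rank of \<open>Y\<close>, the element augmenting
  \<open>J\<close> would have to be \<open>e\<close> itself, so \<open>insert e B\<close> would be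
  independent, which is impossible for \<open>e\<close> in the closure of \<open>X\<close>.\<close>

lemma closure_mono:
  assumes "X \<subseteq> Y"
  shows "closure X \<subseteq> closure Y"
proof
  fix e assume e: "e \<in> closure X"
  obtain B where B: "B \<subseteq> X" "indep B" "card B = rank X" by (rule obtain_basis)
  obtain J where J: "B \<subseteq> J" "J \<subseteq> Y" "indep J" "card J = rank Y"
    using extend_to_basis[OF B(2)] B(1) assms by (metis subset_trans)
  have "\<not> rank Y < rank (insert e Y)"
  proof
    assume "rank Y < rank (insert e Y)"
    then obtain a where a: "a \<in> insert e Y - J" "indep (insert a J)"
      using augment_to_rank[OF J(3)] J(4) by metis
    have "card (insert a J) = Suc (rank Y)"
      using a(1) J finite_indep by simp
    then have "\<not> insert a J \<subseteq> Y"
      using card_le_rank[OF _ a(2)] by fastforce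
    then have "a = e" using a(1) J(2) by auto
    then have "e \<notin> B" "indep (insert e B)"
      using a(1) J(1) indep_mono[OF a(2), of "insert e B"] by auto
    then show False using closure_not_indep_insert[OF e B] by simp
  qed
  then show "e \<in> closure Y"
    using e rank_mono[OF subset_insertI, of Y e] by (auto simp: closure_def)
qed

section \<open>Circuits in modular matroids\<close>

lemma dependent_contains_circuit:
  assumes "X \<subseteq> E" "\<not> indep X"
  obtains C where "C \<subseteq> X" "circuit C"
proof -
  let ?P = "\<lambda>C. C \<subseteq> X \<and> \<not> indep C"
  obtain C where C: "?P C" "\<And>D. ?P D \<Longrightarrow> card C \<le> card D"
    using ex_has_least_nat[of ?P X card] assms by blast
  have "finite C"
    using C(1) assms(1) finite_ground by (meson finite_subset)
  then have "indep D" if "D \<subset> C" for D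
    using C that psubset_card_mono[of C D] by (meson leD order_trans psubset_imp_subset)
  then show thesis
    using C(1) assms(1) by (intro that[of C]) (auto simp: circuit_def)
qed

text \<open>Both parts of the circuit are independent, so the ranks of the flats they span add up to
  \<open>card C\<close>. The union of these flats has rank at most \<open>rank C < card C\<close>,
  so modularity forces their intersection to have positive rank.\<close>

lemma modular_closures_meet:
  assumes "modular" "circuit C" "A \<subseteq> C" "A \<noteq> {}" "A \<noteq> C"
  obtains x where "x \<in> closure A" "x \<in> closure (C - A)" "indep {x}"
proof -
  have C: "C \<subseteq> E" "\<not> indep C" "\<And>D. D \<subset> C \<Longrightarrow> indep D"
    using assms(2) by (auto simp: circuit_def)
  have fin: "finite C" using C(1) finite_ground finite_subset by blast
  have sub: "A \<subseteq> E" "C - A \<subseteq> E" using C(1) assms(3) by auto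
  have "rank A = card A" "rank (C - A) = card (C - A)"
    using assms(3-5) by (auto intro!: rank_indep C(3))
  moreover have "card A + card (C - A) = card C"
    using fin assms(3) card_mono[OF fin assms(3)]
    by (simp add: card_Diff_subset finite_subset)
  ultimately have "rank (closure A) + rank (closure (C - A)) = card C"
    using rank_closure sub by simp
  moreover have "rank (closure A \<union> closure (C - A)) \<le> rank (closure C)"
    using closure_mono[of A C] closure_mono[of "C - A" C] assms(3)
    by (intro rank_mono) auto
  moreover have "rank (closure C) < card C"
    using rank_less_card[OF fin C(2)] rank_closure[OF C(1)] by simp
  moreover have "rank (closure A) + rank (closure (C - A)) =
      rank (closure A \<union> closure (C - A)) + rank (closure A \<inter> closure (C - A))"
    using assms(1) flat_closure sub by (simp add: modular_def)
  \<comment> \<open>Positive rank is phrased through \<open>card {}\<close> so that augmenting the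
    empty set yields a point of the intersection that is not a loop.\<close>
  ultimately have "card {} < rank (closure A \<inter> closure (C - A))"
    by simp
  from augment_to_rank[OF indep_empty this] show thesis
    using that by auto
qed

section \<open>Rainbow sets without rainbow triangles\<close>

text \<open>Stated for all rainbow sets, not only circuits: the smaller sets built in the induction
  are rainbow but not known to be circuits.\<close>

lemma no_rainbow_triangle_imp_rainbow_indep:
  assumes "modular" "simple_colouring c"
    and no_triangle: "\<nexists>T. triangle T \<and> rainbow c T"
    and "X \<subseteq> E" "rainbow c X"
  shows "indep X"
  using assms(4,5)
proof (induction "card X" arbitrary: X rule: less_induct)
  case (less C)
  have fin: "finite C" using less.prems(1) finite_ground finite_subset by blast
  have inj: "inj_on c C" using less.prems(2) by (simp add: rainbow_def)
  show ?case
  proof (rule ccontr)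
    assume dep: "\<not> indep C"
    have proper: "indep D" if "D \<subset> C" for D
      using less.hyps[of D] less.prems(1) inj that psubset_card_mono[OF fin that]
      by (auto simp: rainbow_def intro: inj_on_subset)
    then have circ: "circuit C" using dep less.prems(1) by (simp add: circuit_def)
    \<comment> \<open>Sizes below 4 are excluded: the empty set is independent, and otherwise
      \<open>C\<close> would be a loop, a parallel pair with two colours, or a rainbow
      triangle.\<close>
    have "card C \<noteq> 0" using dep indep_empty fin by auto
    moreover have "card C \<noteq> 1"
      using circ less.prems(1) assms(2)
      by (auto simp: card_1_singleton_iff simple_colouring_def loop_def)
    moreover have "card C \<noteq> 2"
    proof
      assume "card C = 2"
      then obtain e f where "C = {e, f}" "e \<noteq> f" by (auto simp: card_2_iff)
      moreover from this have "c e = c f"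
        using circ assms(2) less.prems(1) by (auto simp: simple_colouring_def parallel_def)
      ultimately show False using inj by auto
    qed
    moreover have "card C \<noteq> 3"
      using circ no_triangle less.prems(2) by (auto simp: triangle_def)
    ultimately have card: "card C \<ge> 4" by linarith
    then obtain e where e: "e \<in> C" by fastforce
    have "card (C - {e}) \<noteq> 0" using card e by simp
    then have "C - {e} \<noteq> {}" by (metis card.empty)
    then obtain f where f: "f \<in> C" "f \<noteq> e" by blast
    let ?A = "{e, f}"
    have cA: "card ?A = 2" and cD: "card (C - ?A) = card C - 2"
      using e f fin by (auto simp: card_Diff_subset)
    then have "?A \<noteq> C" using card by auto
    then obtain x where x: "x \<in> closure ?A" "x \<in> closure (C - ?A)"
      using modular_closures_meet[OF assms(1) circ, of ?A] e f by auto
    have xE: "x \<in> E" using x(1) closure_subset_ground by blast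
    \<comment> \<open>The point \<open>x\<close> raises the rank of neither part, so adding it to a
      part that lacks it gives a dependent set.\<close>
    have rank_line: "rank (insert x ?A) \<le> 2"
      using x(1) rank_le_card[of ?A] cA by (simp add: closure_def)
    have rank_rest: "rank (insert x (C - ?A)) \<le> card C - 2"
      using x(2) rank_le_card[of "C - ?A"] cD fin by (simp add: closure_def)
    show False
    proof (cases "c x \<in> c ` ?A")
      case False
      then have "x \<notin> ?A" by blast
      then have "card (insert x ?A) = 3" using f by simp
      moreover have "rainbow c (insert x ?A)"
        using False inj e f by (auto simp: rainbow_def inj_on_def)
      \<comment> \<open>The induction hypothesis covers this set of size 3 because
        \<open>card C\<close> is at least 4.\<close>
      ultimately have "indep (insert x ?A)"
        using less.hyps[of "insert x ?A"] card e f less.prems(1) xE by auto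
      then show False
        using rank_indep rank_line \<open>card (insert x ?A) = 3\<close> by simp
    next
      case True
      \<comment> \<open>The colour of \<open>x\<close> is already that of \<open>e\<close> or
        \<open>f\<close>, and no other element of the rainbow set \<open>C\<close> has it.\<close>
      then have new: "c x \<notin> c ` (C - ?A)"
        using inj e f by (auto simp: inj_on_def)
      then have cR: "card (insert x (C - ?A)) = card C - 1"
        using cD fin card by (subst card_insert_disjoint) auto
      have "rainbow c (insert x (C - ?A))"
        using new inj_on_diff[OF inj] unfolding rainbow_def inj_on_insert by blast
      then have "indep (insert x (C - ?A))"
        using less.hyps[of "insert x (C - ?A)"] card cR less.prems(1) xE by auto
      then show False
        using rank_indep rank_rest cR card by simp
    qed
  qed
qed

section \<open>Counting colours against rank\<close>

text \<open>Choose one representative in \<open>X\<close> for each colour. The resulting set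
  \<open>R\<close> is rainbow, so it contains no circuit and is independent.\<close>

lemma colours_le_rank:
  assumes "\<nexists>C. circuit C \<and> rainbow c C" "X \<subseteq> E"
  shows "card (c ` X) \<le> rank X"
proof -
  obtain R where R: "R \<subseteq> X" "inj_on c R" "c ` X = c ` R"
    by (metis subset_image_inj subset_refl)
  have "indep R"
  proof (rule ccontr)
    assume "\<not> indep R"
    then obtain C where "C \<subseteq> R" "circuit C"
      using dependent_contains_circuit R(1) assms(2) by (metis subset_trans)
    then show False
      using assms(1) inj_on_subset[OF R(2)] by (auto simp: rainbow_def)
  qed
  then show ?thesis
    using R by (simp add: card_image card_le_rank)
qed

text \<open>A rainbow circuit has as many colours as elements, but being dependent it has smaller
  rank; it thus violates the bound on colours.\<close>

lemma rank_less_colours: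
  assumes "circuit C" "rainbow c C"
  shows "rank C < card (c ` C)"
  using assms rank_less_card[of C] finite_subset[OF _ finite_ground, of C]
  by (simp add: circuit_def rainbow_def card_image)

text \<open>Passing from \<open>X\<close> to its closure keeps the rank and can only add
  colours.\<close>

lemma colours_le_rank_of_flats:
  assumes "\<forall>F. flat F \<longrightarrow> card (c ` F) \<le> rank F" "X \<subseteq> E"
  shows "card (c ` X) \<le> rank X"
proof -
  have "finite (closure X)"
    using closure_subset_ground finite_ground finite_subset by blast
  then have "card (c ` X) \<le> card (c ` closure X)"
    by (intro card_mono finite_imageI image_mono subset_closure assms(2))
  also have "\<dots> \<le> rank (closure X)" using assms flat_closure by blast
  finally show ?thesis using rank_closure[OF assms(2)] by simp
qed

end

theorem theorem5p2:
  fixes E :: "'a set" and indep :: "'a set \<Rightarrow> bool" and c :: "'a \<Rightarrow> 'c"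
  assumes "matroid E indep"
    and "matroid.modular E indep"
    and "matroid.simple_colouring E indep c"
  shows "((\<nexists>T. matroid.triangle E indep T \<and> rainbow c T)
           \<longleftrightarrow> (\<nexists>C. matroid.circuit E indep C \<and> rainbow c C))
       \<and> ((\<nexists>C. matroid.circuit E indep C \<and> rainbow c C)
           \<longleftrightarrow> (\<forall>X. X \<subseteq> E \<longrightarrow> card (c ` X) \<le> matroid.rank indep X))
       \<and> ((\<forall>X. X \<subseteq> E \<longrightarrow> card (c ` X) \<le> matroid.rank indep X)
           \<longleftrightarrow> (\<forall>F. matroid.flat E indep F \<longrightarrow> card (c ` F) \<le> matroid.rank indep F))"
proof -
  interpret matroid E indep by (rule assms(1))
  have "(\<nexists>C. circuit C \<and> rainbow c C)" if "\<nexists>T. triangle T \<and> rainbow c T"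
    using no_rainbow_triangle_imp_rainbow_indep[OF assms(2,3) that]
    unfolding circuit_def by blast
  \<comment> \<open>The converse holds because a triangle is a circuit.\<close>
  then have "(\<nexists>T. triangle T \<and> rainbow c T) \<longleftrightarrow> (\<nexists>C. circuit C \<and> rainbow c C)"
    unfolding triangle_def by blast
  moreover have "(\<nexists>C. circuit C \<and> rainbow c C) \<longleftrightarrow> (\<forall>X. X \<subseteq> E \<longrightarrow> card (c ` X) \<le> rank X)"
  proof
    assume colours: "\<forall>X. X \<subseteq> E \<longrightarrow> card (c ` X) \<le> rank X"
    have "\<not> rainbow c C" if "circuit C" for C
    proof -
      have "card (c ` C) \<le> rank C" using colours that by (simp add: circuit_def)
      then show ?thesis using rank_less_colours[OF that, of c] by linarith
    qed
    then show "\<nexists>C. circuit C \<and> rainbow c C" by blast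
  qed (simp add: colours_le_rank)
  moreover have "(\<forall>X. X \<subseteq> E \<longrightarrow> card (c ` X) \<le> rank X) \<longleftrightarrow>
      (\<forall>F. flat F \<longrightarrow> card (c ` F) \<le> rank F)"
  proof
    show "\<forall>F. flat F \<longrightarrow> card (c ` F) \<le> rank F"
      if "\<forall>X. X \<subseteq> E \<longrightarrow> card (c ` X) \<le> rank X"
      using that by (simp add: flat_def)
  qed (simp add: colours_le_rank_of_flats)
  ultimately show ?thesis by blast
qed

end
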